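(* The space $\mathbb{N}^{\mathbb{N}^{\mathbb{N}}}$ does not satisfy Normann's condition; that is, it contains a functionally closed subset that is not an intersection of clopen sets.
   Context: $\mathbb{N}^{\mathbb{N}^{\mathbb{N}}}$ is the exponential in the category QCB (equivalently in sequential spaces): the set of continuous functions from Baire space $\mathbb{N}^{\mathbb{N}}$ to the discrete space $\mathbb{N}$, topologised by the sequentialisation of the compact-open topology. A subset $A$ of a space $Z$ is functionally closed if $A=\varphi^{-1}[\{0\}]$ for some continuous $\varphi\colon Z\to[0,1]$. A space satisfies Normann's condition if every functionally closed subset is an intersection of clopen sets. *)

theory Defs
  imports "HOL-Analysis.Analysis"
begin

definition baire_space :: "(nat \<Rightarrow> nat) topology" where
  "baire_space = product_topology (\<lambda>_. discrete_topology (UNIV :: nat set)) UNIV"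

definition compact_open_topology :: "'a topology \<Rightarrow> 'b topology \<Rightarrow> ('a \<Rightarrow> 'b) topology" where
  "compact_open_topology X Y =
     topology_generated_by
       {{f. continuous_map X Y f \<and> f ` K \<subseteq> U} | K U. compactin X K \<and> openin Y U}"

definition sequentially_open :: "'a topology \<Rightarrow> 'a set \<Rightarrow> bool" where
  "sequentially_open X U \<longleftrightarrow> U \<subseteq> topspace X \<and>
     (\<forall>\<sigma> x. limitin X \<sigma> x sequentially \<and> x \<in> U \<longrightarrow> eventually (\<lambda>n. \<sigma> n \<in> U) sequentially)"

definition sequentialisation :: "'a topology \<Rightarrow> 'a topology" where
  "sequentialisation X = topology_generated_by {U. sequentially_open X U}"

text \<open>The exponential N^(N^N) in QCB: continuous maps from Baire space to discrete N,
  with the sequentialisation of the compact-open topology.\<close>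
definition NNN :: "((nat \<Rightarrow> nat) \<Rightarrow> nat) topology" where
  "NNN = sequentialisation (compact_open_topology baire_space (discrete_topology UNIV))"

definition functionally_closed :: "'a topology \<Rightarrow> 'a set \<Rightarrow> bool" where
  "functionally_closed Z A \<longleftrightarrow>
     (\<exists>\<phi>. continuous_map Z (subtopology euclideanreal {0..1}) \<phi> \<and>
          A = {z \<in> topspace Z. \<phi> z = 0})"

text \<open>A is an intersection of clopen subsets of Z (the empty intersection being Z).\<close>
definition intersection_of_clopens :: "'a topology \<Rightarrow> 'a set \<Rightarrow> bool" where
  "intersection_of_clopens Z A \<longleftrightarrow>
     (\<exists>\<C>. (\<forall>C\<in>\<C>. closedin Z C \<and> openin Z C) \<and> A = topspace Z \<inter> \<Inter>\<C>)"

definition normann_condition :: "'a topology \<Rightarrow> bool" where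
  "normann_condition Z \<longleftrightarrow>
     (\<forall>A. functionally_closed Z A \<longrightarrow> intersection_of_clopens Z A)"

end

theory Submission
  imports Defs
begin

text \<open>
  Give the sequences \<open>a :: nat \<Rightarrow> nat\<close> of finite weighted mass \<open>\<Sum>k. a k / 2^k\<close> the weighted
  \<open>\<ell>\<^sup>1\<close>-metric. As in Erdos space, every clopen neighbourhood of \<open>0\<close> then contains sequences of mass
  at least \<open>1\<close>, whereas the sequences of mass at least \<open>1\<close> form the zero set of a continuous function.
  A sequence converges in this metric iff it converges coordinatewise with uniformly small tails.
  Such convergence is expressed by functionals: besides the coordinates of \<open>a\<close>, the functional
  \<open>code a\<close> records at the point \<open>(j, 0, \<dots>, 0, m, 0, \<dots>)\<close>, with \<open>m\<close> at position \<open>n\<close>, whether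
  \<open>\<Sum>k=n..m. a k / 2^k \<le> 1/j\<close>. As \<open>n\<close> grows these points tend to \<open>(j, 0, 0, \<dots>)\<close>, so continuity
  at the latter point is smallness of the tails, and convergence of functionals makes it uniform.
  For the same reason the mass extends continuously to all functionals: one drops each coordinate
  that violates a recorded tail bound.
\<close>

section \<open>Baire space and convergence in the compact-open topology\<close>

abbreviation CO :: "((nat \<Rightarrow> nat) \<Rightarrow> nat) topology" where
  "CO \<equiv> compact_open_topology baire_space (discrete_topology UNIV)"

lemma topspace_baire_space [simp]: "topspace baire_space = UNIV"
  by (simp add: baire_space_def)

lemma openin_baire_cylinder: "openin baire_space {x. \<forall>i<L. x i = p i}"
proof -
  have "{x. \<forall>i<L. x i = p i} = (\<Pi>\<^sub>E i\<in>UNIV. if i < L then {p i} else UNIV)"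
    by (auto simp: PiE_iff split: if_splits)
  moreover have "finite {i. (if i < L then {p i} else UNIV) \<noteq> (UNIV :: nat set)}"
    by (rule finite_subset[of _ "{..<L}"]) auto
  ultimately show ?thesis
    unfolding baire_space_def by (auto intro!: product_topology_basis)
qed

lemma limitin_baire:
  assumes "\<And>i. \<forall>\<^sub>F n in sequentially. \<sigma> n i = l i"
  shows "limitin baire_space \<sigma> l sequentially"
  unfolding baire_space_def limitin_componentwise
proof (intro conjI ballI)
  fix i
  show "limitin (discrete_topology UNIV) (\<lambda>n. \<sigma> n i) (l i) sequentially"
    unfolding limitin_def by (auto intro: eventually_mono[OF assms[of i]])
qed auto

lemma topspace_compact_open [simp]:
  "topspace (compact_open_topology X Y) = {f. continuous_map X Y f}"
proof -
  have "\<exists>K U. {f. continuous_map X Y f} = {f. continuous_map X Y f \<and> f ` K \<subseteq> U}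
      \<and> compactin X K \<and> openin Y U"
    by (intro exI[of _ "{}"]) auto
  then show ?thesis
    unfolding compact_open_topology_def topology_generated_by_topspace by blast
qed

lemma limitin_topology_generated_by:
  assumes "l \<in> \<Union>\<S>"
    and "\<And>S. S \<in> \<S> \<Longrightarrow> l \<in> S \<Longrightarrow> \<forall>\<^sub>F n in F. \<sigma> n \<in> S"
  shows "limitin (topology_generated_by \<S>) \<sigma> l F"
proof -
  have "l \<in> S \<longrightarrow> (\<forall>\<^sub>F n in F. \<sigma> n \<in> S)" if "generate_topology_on \<S> S" for S
    using that
  proof induction
    case (Int a b)
    then show ?case by (auto simp: eventually_conj_iff)
  next
    case (UN K)
    show ?case
    proof
      assume "l \<in> \<Union>K"
      then obtain k where "k \<in> K" "l \<in> k" by blast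
      with UN(2) have "\<forall>\<^sub>F n in F. \<sigma> n \<in> k" by blast
      then show "\<forall>\<^sub>F n in F. \<sigma> n \<in> \<Union>K"
        by (rule eventually_mono) (use \<open>k \<in> K\<close> in blast)
    qed
  qed (use assms in auto)
  then show ?thesis
    using assms(1) by (auto simp: limitin_def openin_topology_generated_by_iff)
qed

lemma limitin_compact_open_image:
  assumes "limitin (compact_open_topology X Y) \<sigma> f F" "compactin X K" "openin Y U" "f ` K \<subseteq> U"
  shows "\<forall>\<^sub>F n in F. \<sigma> n ` K \<subseteq> U"
proof -
  let ?S = "{f. continuous_map X Y f \<and> f ` K \<subseteq> U}"
  have "openin (compact_open_topology X Y) ?S"
    unfolding compact_open_topology_def
    by (rule topology_generated_by_Basis) (use assms in blast)
  moreover have "f \<in> ?S"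
    using assms limitin_topspace[OF assms(1)] by auto
  ultimately have "\<forall>\<^sub>F n in F. \<sigma> n \<in> ?S"
    using assms(1) by (auto simp: limitin_def)
  then show ?thesis by (rule eventually_mono) auto
qed

lemma limitin_CO_at:
  assumes "limitin CO \<sigma> f sequentially"
  shows "\<forall>\<^sub>F n in sequentially. \<sigma> n p = f p"
  using limitin_compact_open_image[OF assms, of "{p}" "{f p}"] by simp

text \<open>Finitely many of the cylinders given by \<open>loc\<close> cover \<open>K\<close>, and
  the largest of their thresholds serves all of \<open>K\<close>.\<close>

lemma eventually_baire_local_imp_compact:
  assumes "compactin baire_space K"
    and loc: "\<And>p. \<exists>L I. \<forall>x i. (\<forall>k<L. x k = p k) \<longrightarrow> I \<le> i \<longrightarrow> P i x"
  shows "\<forall>\<^sub>F i in sequentially. \<forall>x\<in>K. P i x"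
proof -
  obtain L I where LI: "\<And>p x i. (\<forall>k<L p. x k = p k) \<Longrightarrow> I p \<le> (i::nat) \<Longrightarrow> P i x"
    using loc by metis
  have op: "openin baire_space U" if "U \<in> range (\<lambda>p. {x. \<forall>k<L p. x k = p k})" for U
    using that openin_baire_cylinder by auto
  have cov: "K \<subseteq> \<Union>(range (\<lambda>p. {x. \<forall>k<L p. x k = p k}))" by auto
  obtain \<F> where \<F>: "finite \<F>" "\<F> \<subseteq> range (\<lambda>p. {x. \<forall>k<L p. x k = p k})" "K \<subseteq> \<Union>\<F>"
    using compactinD[OF assms(1) op cov] by blast
  from finite_subset_image[OF \<F>(1,2)] \<F>(3)
  obtain T where T: "finite T" "K \<subseteq> (\<Union>p\<in>T. {x. \<forall>k<L p. x k = p k})"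
    by auto
  have "\<forall>\<^sub>F i in sequentially. \<forall>p\<in>T. I p \<le> i"
    using T(1) by (simp add: eventually_ball_finite)
  then show ?thesis
    by (rule eventually_mono) (use T(2) LI in blast)
qed

lemma continuous_map_baire_discrete:
  assumes "\<And>p. \<exists>L. \<forall>x. (\<forall>k<L. x k = p k) \<longrightarrow> f x = f p"
  shows "continuous_map baire_space (discrete_topology UNIV) f"
proof -
  have "openin baire_space {x. f x \<in> U}" for U
  proof (subst openin_subopen, intro ballI)
    fix p assume p: "p \<in> {x. f x \<in> U}"
    obtain L where L: "\<And>x. \<forall>k<L. x k = p k \<Longrightarrow> f x = f p"
      using assms by blast
    have "{x. \<forall>k<L. x k = p k} \<subseteq> {x. f x \<in> U}"
    proof
      fix x assume "x \<in> {x. \<forall>k<L. x k = p k}"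
      then have "f x = f p" by (intro L) simp
      with p show "x \<in> {x. f x \<in> U}" by simp
    qed
    then show "\<exists>T. openin baire_space T \<and> p \<in> T \<and> T \<subseteq> {x. f x \<in> U}"
      by (intro exI[of _ "{x. \<forall>k<L. x k = p k}"]) (simp add: openin_baire_cylinder)
  qed
  then show ?thesis by (auto simp: continuous_map_def)
qed

text \<open>Eventual agreement with \<open>f\<close> near each point becomes eventual agreement on
  each compact set. Convergence of functionals can thus be checked one point of Baire space at a
  time.\<close>

lemma limitin_CO_I:
  assumes cont: "continuous_map baire_space (discrete_topology UNIV) f"
    and loc: "\<And>p. \<exists>L I. \<forall>x i. (\<forall>k<L. x k = p k) \<longrightarrow> I \<le> i \<longrightarrow> \<sigma> i x = f x"
    and "\<And>i. continuous_map baire_space (discrete_topology UNIV) (\<sigma> i)"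
  shows "limitin CO \<sigma> f sequentially"
  unfolding compact_open_topology_def
proof (rule limitin_topology_generated_by)
  show "f \<in> \<Union>{{f. continuous_map baire_space (discrete_topology UNIV) f \<and> f ` K \<subseteq> U} |K U.
           compactin baire_space K \<and> openin (discrete_topology UNIV) U}"
    using topspace_compact_open[of baire_space "discrete_topology UNIV"] cont
    unfolding compact_open_topology_def topology_generated_by_topspace by blast
next
  fix S
  assume "S \<in> {{f. continuous_map baire_space (discrete_topology UNIV) f \<and> f ` K \<subseteq> U} |K U.
           compactin baire_space K \<and> openin (discrete_topology UNIV) U}" and f: "f \<in> S"
  then obtain K U where K: "compactin baire_space K"
    and S: "S = {f. continuous_map baire_space (discrete_topology UNIV) f \<and> f ` K \<subseteq> U}"
    by blast
  have "\<forall>\<^sub>F i in sequentially. \<forall>x\<in>K. \<sigma> i x = f x"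
    by (rule eventually_baire_local_imp_compact[OF K loc])
  then show "\<forall>\<^sub>F n in sequentially. \<sigma> n \<in> S"
    by (rule eventually_mono) (use assms f S in auto)
qed

section \<open>Sequentialisation and the space \<open>NNN\<close>\<close>

text \<open>Sequentially open sets are closed under finite intersections and arbitrary unions, so
  generating a topology from them adds no new sets.\<close>

lemma openin_sequentialisation:
  "openin (sequentialisation X) U \<longleftrightarrow> sequentially_open X U"
proof
  assume "openin (sequentialisation X) U"
  then have "generate_topology_on {U. sequentially_open X U} U"
    by (simp add: sequentialisation_def openin_topology_generated_by_iff)
  then show "sequentially_open X U"
  proof induction
    case (Int a b)
    then show ?case
      unfolding sequentially_open_def eventually_conj_iff Int_iff by blast
  next
    case (UN K)
    show ?case
      unfolding sequentially_open_def
    proof (intro conjI allI impI)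
      show "\<Union>K \<subseteq> topspace X"
        using UN by (auto simp: sequentially_open_def)
      fix \<sigma> x assume *: "limitin X \<sigma> x sequentially \<and> x \<in> \<Union>K"
      then obtain k where "k \<in> K" "x \<in> k" by blast
      with UN(2)[of k] * have "\<forall>\<^sub>F n in sequentially. \<sigma> n \<in> k"
        unfolding sequentially_open_def by blast
      then show "\<forall>\<^sub>F n in sequentially. \<sigma> n \<in> \<Union>K"
        by (rule eventually_mono) (use \<open>k \<in> K\<close> in blast)
    qed
  qed (auto simp: sequentially_open_def)
next
  assume "sequentially_open X U"
  then show "openin (sequentialisation X) U"
    unfolding sequentialisation_def by (auto intro: topology_generated_by_Basis)
qed

lemma topspace_sequentialisation [simp]: "topspace (sequentialisation X) = topspace X"
proof -
  have "sequentially_open X (topspace X)"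
    by (auto simp: sequentially_open_def limitin_def)
  then show ?thesis
    unfolding sequentialisation_def topology_generated_by_topspace
    by (auto simp: sequentially_open_def)
qed

lemma topspace_NNN: "topspace NNN = topspace CO"
  by (simp add: NNN_def)

lemma openin_NNN: "openin NNN U \<longleftrightarrow> sequentially_open CO U"
  by (simp add: NNN_def openin_sequentialisation)

lemma continuous_map_NNN_real:
  fixes \<phi> :: "((nat \<Rightarrow> nat) \<Rightarrow> nat) \<Rightarrow> real"
  assumes "\<And>\<sigma> f. limitin CO \<sigma> f sequentially \<Longrightarrow> (\<forall>n. \<sigma> n \<in> topspace CO)
      \<Longrightarrow> (\<lambda>n. \<phi> (\<sigma> n)) \<longlonglongrightarrow> \<phi> f"
  shows "continuous_map NNN euclideanreal \<phi>"
proof -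
  have "sequentially_open CO {f \<in> topspace CO. \<phi> f \<in> V}" if "open V" for V
    unfolding sequentially_open_def
  proof (intro conjI allI impI)
    fix \<sigma> f assume *: "limitin CO \<sigma> f sequentially \<and> f \<in> {f \<in> topspace CO. \<phi> f \<in> V}"
    then have ev: "\<forall>\<^sub>F n in sequentially. \<sigma> n \<in> topspace CO"
      unfolding limitin_def by blast
    \<comment> \<open>Convergence puts only almost all terms in the space; the finitely many others
      are replaced by the limit so that the assumption applies.\<close>
    define \<tau> where "\<tau> n = (if \<sigma> n \<in> topspace CO then \<sigma> n else f)" for n
    have eq: "\<forall>\<^sub>F n in sequentially. \<tau> n = \<sigma> n"
      using ev by (rule eventually_mono) (simp add: \<tau>_def)
    have "limitin CO \<tau> f sequentially"
      by (rule limitin_transform_eventually[of \<sigma>])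
        (use * in \<open>auto intro: eventually_mono[OF eq]\<close>)
    moreover have "\<forall>n. \<tau> n \<in> topspace CO"
      using * by (simp add: \<tau>_def)
    ultimately have "(\<lambda>n. \<phi> (\<tau> n)) \<longlonglongrightarrow> \<phi> f"
      by (rule assms)
    then have "\<forall>\<^sub>F n in sequentially. \<phi> (\<tau> n) \<in> V"
      using * that by (auto dest: topological_tendstoD)
    with ev eq show "\<forall>\<^sub>F n in sequentially. \<sigma> n \<in> {f \<in> topspace CO. \<phi> f \<in> V}"
      by eventually_elim auto
  qed auto
  then show ?thesis
    by (auto simp: continuous_map_def openin_NNN topspace_NNN)
qed

section \<open>Values of functionals at the probe points\<close>

text \<open>The update at \<open>0\<close> comes last. The limit point \<open>(j, 0, 0, ...)\<close>
  is written \<open>probe j 1 0\<close>, and \<open>probe 0 1 k\<close> is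
  \<open>(0, k, 0, ...)\<close>, where a code stores coordinate \<open>k\<close>.\<close>

definition probe :: "nat \<Rightarrow> nat \<Rightarrow> nat \<Rightarrow> nat \<Rightarrow> nat" where
  "probe j n m = (\<lambda>_. 0)(n := m, 0 := j)"

lemma limitin_probe:
  assumes "filterlim \<nu> at_top sequentially"
  shows "limitin baire_space (\<lambda>n. probe j (\<nu> n) (\<mu> n)) (probe j 1 0) sequentially"
proof (rule limitin_baire)
  fix i
  have "\<forall>\<^sub>F n in sequentially. i < \<nu> n"
    using assms unfolding filterlim_at_top by (meson Suc_le_lessD eventually_mono)
  then show "\<forall>\<^sub>F n in sequentially. probe j (\<nu> n) (\<mu> n) i = probe j 1 0 i"
    by (rule eventually_mono) (auto simp: probe_def)
qed

text \<open>Otherwise exceptional probes with \<open>n\<close> tending to infinity would contradict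
  continuity at their limit \<open>probe j 1 0\<close>.\<close>

lemma probe_eventually_constant:
  assumes "continuous_map baire_space (discrete_topology UNIV) f"
  shows "\<exists>N. \<forall>n\<ge>N. \<forall>m. f (probe j n m) = f (probe j 1 0)"
proof (rule ccontr)
  assume "\<not> ?thesis"
  then have "\<forall>N. \<exists>n m. N \<le> n \<and> f (probe j n m) \<noteq> f (probe j 1 0)" by blast
  then obtain \<nu> \<mu> where *: "\<And>N. N \<le> \<nu> N" "\<And>N. f (probe j (\<nu> N) (\<mu> N)) \<noteq> f (probe j 1 0)"
    by metis
  have "filterlim \<nu> at_top sequentially"
    by (rule filterlim_at_top_mono[OF filterlim_ident]) (simp add: *)
  from limitin_probe[OF this]
  have lim: "limitin baire_space (\<lambda>n. probe j (\<nu> n) (\<mu> n)) (probe j 1 0) sequentially" .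
  have "openin baire_space {x \<in> topspace baire_space. f x \<in> {f (probe j 1 0)}}"
    using assms unfolding continuous_map_def by (metis openin_discrete_topology subset_UNIV)
  with lim have "\<forall>\<^sub>F n in sequentially.
      probe j (\<nu> n) (\<mu> n) \<in> {x \<in> topspace baire_space. f x \<in> {f (probe j 1 0)}}"
    unfolding limitin_def by blast
  then show False using *(2) by (auto dest: eventually_happens)
qed

text \<open>Counterexamples for larger and larger \<open>N\<close>, together with their limit point,
  form a compact set. Convergence in \<open>CO\<close> is uniform there, which yields one threshold
  for all late \<open>\<sigma> i\<close>.\<close>

lemma probe_eventually_constant_uniform:
  assumes lim: "limitin CO \<sigma> f sequentially"
  shows "\<exists>N. \<forall>i\<ge>N. \<forall>n\<ge>N. \<forall>m. \<sigma> i (probe j n m) = \<sigma> i (probe j 1 0)"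
proof (rule ccontr)
  assume contra: "\<not> ?thesis"
  have "continuous_map baire_space (discrete_topology UNIV) f"
    using limitin_topspace[OF lim] by simp
  then obtain N0 where N0: "\<And>n m. N0 \<le> n \<Longrightarrow> f (probe j n m) = f (probe j 1 0)"
    using probe_eventually_constant by blast
  \<comment> \<open>Taking \<open>n\<close> beyond \<open>N0\<close> makes \<open>f\<close> itself
    constant on the compact set formed below.\<close>
  have "\<exists>i n m. N \<le> i \<and> max N N0 \<le> n \<and> \<sigma> i (probe j n m) \<noteq> \<sigma> i (probe j 1 0)" for N
  proof -
    from contra obtain i n m where "max N N0 \<le> i" "max N N0 \<le> n"
      "\<sigma> i (probe j n m) \<noteq> \<sigma> i (probe j 1 0)"
      by blast
    then show ?thesis by (meson max.boundedE)
  qed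
  then obtain \<iota> \<nu> \<mu> where *: "\<And>N. N \<le> \<iota> N" "\<And>N. max N N0 \<le> \<nu> N"
      "\<And>N. \<sigma> (\<iota> N) (probe j (\<nu> N) (\<mu> N)) \<noteq> \<sigma> (\<iota> N) (probe j 1 0)"
    by metis
  let ?q = "\<lambda>N. probe j (\<nu> N) (\<mu> N)"
  let ?K = "insert (probe j 1 0) (range ?q)"
  have "filterlim \<nu> at_top sequentially"
    by (rule filterlim_at_top_mono[OF filterlim_ident]) (use *(2) in auto)
  then have "compactin baire_space ?K"
    by (rule compactin_sequence_with_limit[OF limitin_probe]) auto
  moreover have "f ` ?K \<subseteq> {f (probe j 1 0)}"
    using N0 *(2) by auto
  ultimately have "\<forall>\<^sub>F i in sequentially. \<sigma> i ` ?K \<subseteq> {f (probe j 1 0)}"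
    by (intro limitin_compact_open_image[OF lim]) auto
  then obtain I where "\<sigma> i ` ?K \<subseteq> {f (probe j 1 0)}" if "I \<le> i" for i
    by (auto simp: eventually_sequentially)
  from this[OF *(1)] *(3)[of I] show False by auto
qed

section \<open>Coding weighted sequences as functionals\<close>

definition block :: "(nat \<Rightarrow> nat) \<Rightarrow> nat \<Rightarrow> nat \<Rightarrow> real" where
  "block a n m = (\<Sum>k=n..m. real (a k) / 2 ^ k)"

text \<open>The value \<open>1\<close> at \<open>(j, 0, 0, ...)\<close> with positive
  \<open>j\<close> is the verdict of a bound that holds, so continuity there forces the bound
  \<open>1 / j\<close> on all blocks starting far enough out.\<close>

definition code :: "(nat \<Rightarrow> nat) \<Rightarrow> (nat \<Rightarrow> nat) \<Rightarrow> nat" where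
  "code a p =
    (if p 0 = 0 then a (p 1)
     else if \<forall>i>0. p i = 0 then 1
     else let n = LEAST i. 0 < i \<and> p i \<noteq> 0 in of_bool (block a n (p n) \<le> 1 / p 0))"

lemma code_coord: "code a (probe 0 1 k) = a k"
  by (simp add: code_def probe_def)

lemma code_probe_limit: "0 < j \<Longrightarrow> code a (probe j 1 0) = 1"
  by (simp add: code_def probe_def)

lemma code_probe:
  assumes "0 < j" "0 < n" "0 < m"
  shows "code a (probe j n m) = of_bool (block a n m \<le> 1 / j)"
proof -
  have "(LEAST i. 0 < i \<and> probe j n m i \<noteq> 0) = n"
    using assms by (intro Least_equality) (auto simp: probe_def split: if_splits)
  moreover have "\<not> (\<forall>i>0. probe j n m i = 0)" "probe j n m n = m" "probe j n m 0 = j"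
    using assms by (auto simp: probe_def)
  ultimately show ?thesis
    using assms by (simp add: code_def Let_def)
qed

text \<open>At a point with \<open>p 0 = 0\<close> one coordinate is read, at
  \<open>(j, 0, 0, ...)\<close> the uniform tails decide, and at any other point a single finite
  block is compared. Constant sequences \<open>b\<close> give continuity of a code, general ones
  convergence of codes.\<close>

lemma code_locally_constant:
  assumes ev: "\<And>k. \<forall>\<^sub>F i in sequentially. b i k = a k"
    and tails: "\<And>\<epsilon>. 0 < \<epsilon> \<Longrightarrow> \<exists>N. \<forall>i. \<forall>n\<ge>N. \<forall>m. block (b i) n m \<le> \<epsilon>"
  shows "\<exists>L I. \<forall>x i. (\<forall>k<L. x k = p k) \<longrightarrow> I \<le> i \<longrightarrow> code (b i) x = code a p"
proof -
  consider "p 0 = 0" | "p 0 > 0" "\<forall>i>0. p i = 0" | i where "p 0 > 0" "i > 0" "p i \<noteq> 0" by auto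
  then show ?thesis
  proof cases
    case 1
    obtain I where "\<And>i. I \<le> i \<Longrightarrow> b i (p 1) = a (p 1)"
      using ev by (meson eventually_sequentially)
    with 1 show ?thesis
      by (intro exI[of _ 2] exI[of _ I]) (simp add: code_def numeral_2_eq_2)
  next
    case 2
    have "\<exists>N. \<forall>i. \<forall>n\<ge>N. \<forall>m. block (b i) n m \<le> 1 / p 0"
      by (rule tails) (use 2 in simp)
    then obtain N where N: "\<And>i n m. n \<ge> N \<Longrightarrow> block (b i) n m \<le> 1 / p 0"
      by blast
    \<comment> \<open>The first non-zero entry of \<open>x\<close> after position \<open>0\<close>,
      if there is one, lies beyond \<open>N\<close>, so the block tested belongs to the small
      tail.\<close>
    have "code (b i) x = 1" if x: "\<forall>k<Suc N. x k = p k" for x i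
    proof (cases "\<forall>k>0. x k = 0")
      case False
      define n where "n = (LEAST k. 0 < k \<and> x k \<noteq> 0)"
      have least: "(LEAST k. 0 < k \<and> x k \<noteq> 0) = n"
        by (simp only: n_def)
      have n: "0 < n \<and> x n \<noteq> 0"
        unfolding n_def by (rule LeastI_ex) (use False in blast)
      have "\<not> n < Suc N"
        using n x 2(2) by auto
      then have "block (b i) n (x n) \<le> 1 / p 0"
        by (intro N) simp
      moreover have "x 0 = p 0"
        using x by simp
      ultimately show ?thesis
        using False 2(1) least by (simp add: code_def Let_def)
    qed (use x 2 in \<open>simp add: code_def\<close>)
    with 2 show ?thesis
      by (intro exI[of _ "Suc N"] exI[of _ 0]) (simp add: code_def)
  next
    case 3
    define n where "n = (LEAST k. 0 < k \<and> p k \<noteq> 0)"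
    have n: "0 < n" "p n \<noteq> 0"
      using LeastI[of "\<lambda>k. 0 < k \<and> p k \<noteq> 0" i] 3 unfolding n_def by blast+
    have n': "p k = 0" if "0 < k" "k < n" for k
      using not_less_Least[of k "\<lambda>k. 0 < k \<and> p k \<noteq> 0"] that unfolding n_def by blast
    have code: "code c x = of_bool (block c n (p n) \<le> 1 / p 0)"
      if x: "\<forall>k<Suc n. x k = p k" for c x
    proof -
      have "(LEAST k. 0 < k \<and> x k \<noteq> 0) = n"
      proof (rule Least_equality)
        fix y assume "0 < y \<and> x y \<noteq> 0"
        then show "n \<le> y" using n'[of y] x by (cases "y < n") auto
      qed (use n x in auto)
      moreover have "\<not> (\<forall>k>0. x k = 0)" using n x by auto
      ultimately show ?thesis using x 3(1) by (simp add: code_def Let_def)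
    qed
    have "\<forall>\<^sub>F i in sequentially. \<forall>k\<in>{n..p n}. b i k = a k"
      using ev by (simp add: eventually_ball_finite)
    then obtain I where I: "\<And>i k. I \<le> i \<Longrightarrow> k \<in> {n..p n} \<Longrightarrow> b i k = a k"
      unfolding eventually_sequentially by blast
    have "block (b i) n (p n) = block a n (p n)" if "I \<le> i" for i
      unfolding block_def using I[OF that] by (intro sum.cong) auto
    then show ?thesis
      by (intro exI[of _ "Suc n"] exI[of _ I]) (simp add: code)
  qed
qed

lemma block_tail_small:
  assumes "summable (\<lambda>k. real (a k) / 2 ^ k)" "0 < \<epsilon>"
  shows "\<exists>N. \<forall>n\<ge>N. \<forall>m. block a n m \<le> \<epsilon>"
proof -
  obtain N where N: "\<And>m n. N \<le> m \<Longrightarrow> norm (\<Sum>k=m..<n. real (a k) / 2 ^ k) < \<epsilon>"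
    using assms unfolding summable_Cauchy by blast
  have "block a n m \<le> \<epsilon>" if "N \<le> n" for n m
    using N[OF that, of "Suc m"] by (simp add: block_def atLeastLessThanSuc_atLeastAtMost)
  then show ?thesis by blast
qed

lemma code_locally_constant_self:
  assumes "summable (\<lambda>k. real (a k) / 2 ^ k)"
  shows "\<exists>L. \<forall>x. (\<forall>k<L. x k = p k) \<longrightarrow> code a x = code a p"
proof -
  have "\<exists>L I. \<forall>x i. (\<forall>k<L. x k = p k) \<longrightarrow> (I::nat) \<le> i \<longrightarrow> code a x = code a p"
    by (rule code_locally_constant) (use block_tail_small[OF assms] in auto)
  then show ?thesis by blast
qed

lemma continuous_code:
  assumes "summable (\<lambda>k. real (a k) / 2 ^ k)"
  shows "continuous_map baire_space (discrete_topology UNIV) (code a)"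
  by (intro continuous_map_baire_discrete code_locally_constant_self assms)

lemma limitin_code:
  assumes "\<And>i. summable (\<lambda>k. real (b i k) / 2 ^ k)" "summable (\<lambda>k. real (a k) / 2 ^ k)"
    and "\<And>k. \<forall>\<^sub>F i in sequentially. b i k = a k"
    and "\<And>\<epsilon>. 0 < \<epsilon> \<Longrightarrow> \<exists>N. \<forall>i. \<forall>n\<ge>N. \<forall>m. block (b i) n m \<le> \<epsilon>"
  shows "limitin CO (\<lambda>i. code (b i)) (code a) sequentially"
proof (rule limitin_CO_I)
  fix p
  obtain L I where 1: "\<And>x i. \<forall>k<L. x k = p k \<Longrightarrow> I \<le> i \<Longrightarrow> code (b i) x = code a p"
    using code_locally_constant[of b a p, OF assms(3,4)] by blast
  obtain M where 2: "\<And>x. \<forall>k<M. x k = p k \<Longrightarrow> code a x = code a p"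
    using code_locally_constant_self[OF assms(2), of p] by blast
  show "\<exists>L I. \<forall>x i. (\<forall>k<L. x k = p k) \<longrightarrow> I \<le> i \<longrightarrow> code (b i) x = code a x"
  proof (rule exI[of _ "max L M"], rule exI[of _ I], intro allI impI)
    fix x i assume "\<forall>k<max L M. x k = p k" "I \<le> i"
    then show "code (b i) x = code a x"
      using 1[of x i] 2[of x] by simp
  qed
qed (use assms continuous_code in auto)

section \<open>Extending the mass to all functionals\<close>

definition coord :: "((nat \<Rightarrow> nat) \<Rightarrow> nat) \<Rightarrow> nat \<Rightarrow> nat" where
  "coord f k = f (probe 0 1 k)"

text \<open>The premise is how \<open>f\<close> records the bound \<open>1 / j\<close>, since codes
  take the value \<open>1\<close> at \<open>probe j 1 0\<close>. Bounding \<open>j\<close> and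
  \<open>n\<close> by \<open>m\<close> makes the guard depend on finitely many values of
  \<open>f\<close>.\<close>

definition guard :: "((nat \<Rightarrow> nat) \<Rightarrow> nat) \<Rightarrow> nat \<Rightarrow> bool" where
  "guard f m \<longleftrightarrow> (\<forall>j\<in>{1..m}. \<forall>n\<in>{1..m}.
     f (probe j n m) = f (probe j 1 0) \<longrightarrow> block (coord f) n m \<le> 1 / j)"

definition summand :: "((nat \<Rightarrow> nat) \<Rightarrow> nat) \<Rightarrow> nat \<Rightarrow> real" where
  "summand f k = (if guard f k then real (coord f k) / 2 ^ k else 0)"

definition mass :: "((nat \<Rightarrow> nat) \<Rightarrow> nat) \<Rightarrow> real" where
  "mass f = suminf (summand f)"

lemma summand_nonneg: "0 \<le> summand f k"
  by (simp add: summand_def)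

text \<open>A code records only true bounds, so every guard passes and no coordinate is
  dropped.\<close>

lemma summand_code: "summand (code a) k = real (a k) / 2 ^ k"
proof -
  have [simp]: "coord (code a) = a"
    by (simp add: coord_def code_coord fun_eq_iff del: One_nat_def)
  have "guard (code a) k"
    unfolding guard_def by (auto simp: code_probe code_probe_limit simp del: One_nat_def)
  then show ?thesis by (simp add: summand_def)
qed

text \<open>The last index in the block that passes its guard bounds the whole block.\<close>

lemma summand_block_le:
  assumes N: "0 < j" "j \<le> N" and const: "\<And>n m. N \<le> n \<Longrightarrow> f (probe j n m) = f (probe j 1 0)"
    and "N \<le> n"
  shows "(\<Sum>k=n..<m. summand f k) \<le> 1 / j"
proof (cases "\<exists>k\<in>{n..<m}. guard f k")
  case True
  define S where "S = {k \<in> {n..<m}. guard f k}"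
  define l where "l = Max S"
  have "finite S" "S \<noteq> {}" using True by (auto simp: S_def)
  then have l: "l \<in> S" "\<And>k. k \<in> S \<Longrightarrow> k \<le> l" by (auto simp: l_def)
  have "(\<Sum>k=n..<m. summand f k) = (\<Sum>k\<in>S. summand f k)"
    by (rule sum.mono_neutral_right) (auto simp: S_def summand_def)
  also have "\<dots> \<le> (\<Sum>k\<in>S. real (coord f k) / 2 ^ k)"
    by (rule sum_mono) (simp add: summand_def)
  also have "\<dots> \<le> block (coord f) n l"
    unfolding block_def by (rule sum_mono2) (use l in \<open>auto simp: S_def\<close>)
  \<comment> \<open>The guard of \<open>l\<close> applies to the pair \<open>j\<close>,
    \<open>n\<close> because \<open>j \<le> N \<le> n \<le> l\<close>.\<close>
  also have "\<dots> \<le> 1 / j"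
    using l(1) const[OF assms(4)] assms(1,2,4) by (auto simp: S_def guard_def)
  finally show ?thesis .
next
  case False
  then have "(\<Sum>k=n..<m. summand f k) = 0"
    by (intro sum.neutral) (auto simp: summand_def)
  then show ?thesis by simp
qed

text \<open>The cut-off \<open>N\<close> depends on \<open>f\<close> only through where its probes
  become constant, so one \<open>N\<close> can serve a whole convergent sequence.\<close>

lemma summand_tail:
  assumes N: "0 < j" "j \<le> N" and const: "\<And>n m. N \<le> n \<Longrightarrow> f (probe j n m) = f (probe j 1 0)"
  shows "summable (summand f)" "mass f \<in> {sum (summand f) {..<N}..sum (summand f) {..<N} + 1 / j}"
proof -
  have le: "sum (summand f) {..<M} \<le> sum (summand f) {..<N} + 1 / j" for M
  proof (cases "N \<le> M")
    case True
    then have "sum (summand f) {..<M} = sum (summand f) {..<N} + sum (summand f) {N..<M}"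
      by (metis atLeast0LessThan le0 sum.atLeastLessThan_concat)
    moreover have "sum (summand f) {N..<M} \<le> 1 / j"
      by (rule summand_block_le[OF N]) (use const in auto)
    ultimately show ?thesis by simp
  next
    case False
    then have "sum (summand f) {..<M} \<le> sum (summand f) {..<N}"
      by (intro sum_mono2) (auto simp: summand_nonneg)
    then show ?thesis by (simp add: add_increasing2)
  qed
  show s: "summable (summand f)"
    by (rule bounded_imp_summable[where B = "sum (summand f) {..<N} + 1 / j"])
      (use le[of "Suc _"] in \<open>auto simp: summand_nonneg lessThan_Suc_atMost\<close>)
  show "mass f \<in> {sum (summand f) {..<N}..sum (summand f) {..<N} + 1 / j}"
    unfolding mass_def using suminf_le_const[OF s le] sum_le_suminf[OF s, of "{..<N}"]
    by (auto simp: summand_nonneg)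
qed

text \<open>A single summand is determined by finitely many values of the functional, and each of
  these is eventually constant along the sequence.\<close>

lemma eventually_summand_eq:
  assumes "limitin CO \<sigma> f sequentially"
  shows "\<forall>\<^sub>F i in sequentially. summand (\<sigma> i) k = summand f k"
proof -
  note at = limitin_CO_at[OF assms]
  have "\<forall>\<^sub>F i in sequentially. \<forall>l\<in>{..k}. \<sigma> i (probe 0 1 l) = f (probe 0 1 l)"
    using at by (simp add: eventually_ball_finite)
  moreover have "\<forall>\<^sub>F i in sequentially. \<forall>j\<in>{1..k}. \<forall>n\<in>{1..k}.
      \<sigma> i (probe j n k) = f (probe j n k)"
    using at by (simp add: eventually_ball_finite)
  moreover have "\<forall>\<^sub>F i in sequentially. \<forall>j\<in>{1..k}. \<sigma> i (probe j 1 0) = f (probe j 1 0)"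
    using at by (simp add: eventually_ball_finite)
  ultimately show ?thesis
  proof eventually_elim
    case (elim i)
    have "block (coord (\<sigma> i)) n k = block (coord f) n k" for n
      unfolding block_def coord_def using elim(1) by (intro sum.cong) auto
    then have "guard (\<sigma> i) k = guard f k"
      unfolding guard_def using elim(2,3) by auto
    then show ?case using elim(1) by (simp add: summand_def coord_def)
  qed
qed

text \<open>With a common cut-off and eventually equal partial sums, the masses of
  \<open>\<sigma> i\<close> and \<open>f\<close> lie in the same interval of length
  \<open>1 / j\<close>.\<close>

lemma mass_tendsto:
  assumes lim: "limitin CO \<sigma> f sequentially"
  shows "(\<lambda>i. mass (\<sigma> i)) \<longlonglongrightarrow> mass f"
proof (rule tendstoI)
  fix e :: real assume "0 < e"
  then obtain j where j: "0 < j" "1 / real j < e"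
    by (metis inverse_eq_divide reals_Archimedean zero_less_Suc)
  obtain N1 where N1: "\<And>i n m. N1 \<le> i \<Longrightarrow> N1 \<le> n \<Longrightarrow> \<sigma> i (probe j n m) = \<sigma> i (probe j 1 0)"
    using probe_eventually_constant_uniform[OF lim] by blast
  obtain N2 where N2: "\<And>n m. N2 \<le> n \<Longrightarrow> f (probe j n m) = f (probe j 1 0)"
    using probe_eventually_constant limitin_topspace[OF lim] by (metis mem_Collect_eq topspace_compact_open)
  define N where "N = max j (max N1 N2)"
  have f: "mass f \<in> {sum (summand f) {..<N}..sum (summand f) {..<N} + 1 / j}"
    by (rule summand_tail) (use j N2 in \<open>auto simp: N_def\<close>)
  have "\<forall>\<^sub>F i in sequentially. \<forall>k\<in>{..<N}. summand (\<sigma> i) k = summand f k"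
    using eventually_summand_eq[OF lim] by (simp add: eventually_ball_finite)
  with eventually_ge_at_top[of N1]
  show "\<forall>\<^sub>F i in sequentially. dist (mass (\<sigma> i)) (mass f) < e"
  proof eventually_elim
    case (elim i)
    have "mass (\<sigma> i) \<in> {sum (summand (\<sigma> i)) {..<N}..sum (summand (\<sigma> i)) {..<N} + 1 / j}"
      by (rule summand_tail) (use j N1 elim in \<open>auto simp: N_def\<close>)
    moreover have "sum (summand (\<sigma> i)) {..<N} = sum (summand f) {..<N}"
      using elim by (intro sum.cong) auto
    ultimately show ?case using f j by (auto simp: dist_real_def)
  qed
qed

lemma functionally_closed_mass:
  "functionally_closed NNN {f \<in> topspace NNN. 1 \<le> mass f}"
proof -
  \<comment> \<open>Truncation at \<open>0\<close> makes the zero set exactly mass at least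
    \<open>1\<close>; nonnegativity of the mass keeps the values at most \<open>1\<close>.\<close>
  define \<phi> where "\<phi> f = max 0 (1 - mass f)" for f
  have nonneg: "0 \<le> mass f" if "f \<in> topspace NNN" for f
  proof -
    have "continuous_map baire_space (discrete_topology UNIV) f"
      using that by (simp add: topspace_NNN)
    then obtain N where N: "\<And>n m. N \<le> n \<Longrightarrow> f (probe 1 n m) = f (probe 1 1 0)"
      using probe_eventually_constant by blast
    have "summable (summand f)"
      by (rule summand_tail(1)[of 1 "max 1 N"]) (use N in auto)
    then show ?thesis
      by (simp add: mass_def suminf_nonneg summand_nonneg)
  qed
  have "continuous_map NNN euclideanreal \<phi>"
    by (rule continuous_map_NNN_real) (auto simp: \<phi>_def intro!: tendsto_intros mass_tendsto)
  then have "continuous_map NNN (subtopology euclideanreal {0..1}) \<phi>"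
    using nonneg by (auto simp: continuous_map_in_subtopology \<phi>_def)
  moreover have "{f \<in> topspace NNN. 1 \<le> mass f} = {f \<in> topspace NNN. \<phi> f = 0}"
    by (auto simp: \<phi>_def)
  ultimately show ?thesis unfolding functionally_closed_def by blast
qed

section \<open>Clopen sets and the Erdos argument\<close>

lemma summable_finite_support:
  assumes "\<forall>k\<ge>n. s k = 0"
  shows "summable (\<lambda>k. real (s k) / 2 ^ k)"
  by (rule summable_finite[of "{..<n}"]) (use assms in auto)

text \<open>Both \<open>C\<close> and its complement are sequentially open, so membership passes
  from the terms to the limit as well as back.\<close>

lemma clopen_NNN_code_limit:
  assumes C: "openin NNN C" "closedin NNN C" and lim: "limitin CO (\<lambda>i. code (b i)) (code a) sequentially"
  shows "code a \<in> C \<longleftrightarrow> (\<forall>\<^sub>F i in sequentially. code (b i) \<in> C)"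
proof
  assume "code a \<in> C"
  with C(1) lim show "\<forall>\<^sub>F i in sequentially. code (b i) \<in> C"
    by (auto simp: openin_NNN sequentially_open_def)
next
  assume ev: "\<forall>\<^sub>F i in sequentially. code (b i) \<in> C"
  show "code a \<in> C"
  proof (rule ccontr)
    assume "code a \<notin> C"
    moreover have "sequentially_open CO (topspace NNN - C)"
      using C(2) by (simp add: closedin_def openin_NNN)
    ultimately have "\<forall>\<^sub>F i in sequentially. code (b i) \<in> topspace NNN - C"
      using lim limitin_topspace[OF lim] unfolding sequentially_open_def topspace_NNN by blast
    with ev have "\<forall>\<^sub>F i in sequentially. False"
      by eventually_elim auto
    then show False by simp
  qed
qed

text \<open>Erdos's argument: starting from the zero sequence, raise the coordinates one after the other,
  each time as far as possible without entering \<open>C\<close>. The resulting sequence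
  is a limit both of its truncations (outside \<open>C\<close>) and of the truncations with
  the last coordinate increased by one (inside \<open>C\<close>).\<close>

lemma code_zero_in_clopen:
  assumes C: "openin NNN C" "closedin NNN C" and sub: "{f \<in> topspace NNN. 1 \<le> mass f} \<subseteq> C"
  shows "code (\<lambda>_. 0) \<in> C"
proof (rule ccontr)
  assume zero: "code (\<lambda>_. 0) \<notin> C"
  have big: "code s \<in> C" if "summable (\<lambda>k. real (s k) / 2 ^ k)" "1 \<le> (\<Sum>k. real (s k) / 2 ^ k)" for s
  proof -
    have "summand (code s) = (\<lambda>k. real (s k) / 2 ^ k)"
      by (simp add: summand_code fun_eq_iff)
    then show ?thesis
      using sub that continuous_code[OF that(1)] by (auto simp: topspace_NNN mass_def)
  qed
  \<comment> \<open>\<open>?P\<close> describes the sequence before coordinate \<open>n\<close> is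
    treated; \<open>?Q\<close> says that only this coordinate changes and that one more unit there
    would enter \<open>C\<close>.\<close>
  let ?P = "\<lambda>n s. code s \<notin> C \<and> (\<forall>k\<ge>n. s k = (0::nat))"
  let ?Q = "\<lambda>n s s'. (\<forall>k. k \<noteq> n \<longrightarrow> s' k = s k) \<and> code (s'(n := Suc (s' n))) \<in> C"
  have "\<exists>s. \<forall>n. ?P n (s n) \<and> ?Q n (s n) (s (Suc n))"
  proof (rule dependent_nat_choice)
    show "\<exists>s. ?P 0 s" using zero by (intro exI[of _ "\<lambda>_. 0"]) simp
  next
    fix s :: "nat \<Rightarrow> nat" and n assume P: "?P n s"
    \<comment> \<open>The value \<open>2 ^ n\<close> at position \<open>n\<close> alone has mass
      \<open>1\<close>, so raising this coordinate must eventually meet \<open>C\<close>.\<close>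
    have "code (s(n := 2 ^ n)) \<in> C"
    proof (rule big)
      show s: "summable (\<lambda>k. real ((s(n := 2 ^ n)) k) / 2 ^ k)"
        by (rule summable_finite_support[of "Suc n"]) (use P in auto)
      show "1 \<le> (\<Sum>k. real ((s(n := 2 ^ n)) k) / 2 ^ k)"
        using sum_le_suminf[OF s, of "{n}"] by simp
    qed
    then have ex: "\<exists>v. code (s(n := v)) \<in> C" by blast
    define v where "v = (LEAST v. code (s(n := v)) \<in> C)"
    have v: "code (s(n := v)) \<in> C" unfolding v_def using ex by (rule LeastI_ex)
    have "s(n := 0) = s" using P by auto
    then have "v \<noteq> 0" using v P by metis
    then obtain u where u: "v = Suc u" by (cases v) auto
    have "code (s(n := u)) \<notin> C"
      using not_less_Least[of u "\<lambda>v. code (s(n := v)) \<in> C"] u unfolding v_def by simp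
    then show "\<exists>s'. ?P (Suc n) s' \<and> ?Q n s s'"
      using P v u by (intro exI[of _ "s(n := u)"]) simp
  qed
  then obtain s where out: "\<And>n. code (s n) \<notin> C" and supp: "\<And>n k. n \<le> k \<Longrightarrow> s n k = 0"
    and step: "\<And>n k. k \<noteq> n \<Longrightarrow> s (Suc n) k = s n k"
    and inC: "\<And>n. code ((s (Suc n))(n := Suc (s (Suc n) n))) \<in> C"
    by blast
  define t where "t n = (s (Suc n))(n := Suc (s (Suc n) n))" for n
  \<comment> \<open>The diagonal: coordinate \<open>k\<close> has its final value from stage
    \<open>Suc k\<close> on.\<close>
  define a where "a k = s (Suc k) k" for k
  have s_eq: "s n k = a k" if "k < n" for n k
    using that
  proof (induction n)
    case (Suc n)
    then show ?case by (cases "k = n") (auto simp: a_def step)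
  qed simp
  have s_sum: "summable (\<lambda>k. real (s n k) / 2 ^ k)" for n
    by (rule summable_finite_support[of n]) (simp add: supp)
  have t_sum: "summable (\<lambda>k. real (t n k) / 2 ^ k)" for n
    by (rule summable_finite_support[of "Suc n"]) (simp add: supp t_def)
  have a_sum: "summable (\<lambda>k. real (a k) / 2 ^ k)"
  proof (rule bounded_imp_summable[where B = 1])
    fix n
    have "(\<Sum>k\<le>n. real (a k) / 2 ^ k) = (\<Sum>k\<le>n. real (s (Suc n) k) / 2 ^ k)"
      by (intro sum.cong) (auto simp: s_eq)
    also have "\<dots> \<le> (\<Sum>k. real (s (Suc n) k) / 2 ^ k)"
      by (rule sum_le_suminf[OF s_sum]) auto
    \<comment> \<open>Truncations stay outside \<open>C\<close>, hence have mass below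
      \<open>1\<close>.\<close>
    also have "\<dots> \<le> 1"
      using big[OF s_sum] out[of "Suc n"] by (meson le_cases)
    finally show "(\<Sum>k\<le>n. real (a k) / 2 ^ k) \<le> 1" .
  qed simp
  have s_le: "s n k \<le> a k" for n k
    by (cases "k < n") (simp_all add: s_eq supp)
  have s_ev: "\<forall>\<^sub>F i in sequentially. s i k = a k" for k
    using eventually_gt_at_top[of k] by (rule eventually_mono) (simp add: s_eq)
  have t_ev: "\<forall>\<^sub>F i in sequentially. t i k = a k" for k
    using eventually_gt_at_top[of k] by (rule eventually_mono) (simp add: s_eq t_def)
  have s_block: "block (s i) n m \<le> block a n m" for i n m
    unfolding block_def by (intro sum_mono divide_right_mono) (auto simp: s_le)
  \<comment> \<open>The extra unit at position \<open>i\<close> weighs \<open>1 / 2 ^ i\<close>, and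
    it counts only if \<open>n \<le> i\<close>.\<close>
  have t_block: "block (t i) n m \<le> block a n m + 1 / 2 ^ n" for i n m
  proof -
    have "block (t i) n m \<le> (\<Sum>k=n..m. real (a k) / 2 ^ k + (if k = i then 1 / 2 ^ k else 0))"
      unfolding block_def
      by (intro sum_mono) (auto simp: t_def s_le add_divide_distrib[symmetric] intro!: divide_right_mono)
    also have "\<dots> = block a n m + (if i \<in> {n..m} then 1 / 2 ^ i else 0)"
      by (simp add: sum.distrib block_def)
    also have "\<dots> \<le> block a n m + 1 / 2 ^ n"
      by (auto intro: divide_left_mono power_increasing)
    finally show ?thesis .
  qed
  have "limitin CO (\<lambda>i. code (s i)) (code a) sequentially"
  proof (rule limitin_code[OF s_sum a_sum s_ev])
    fix \<epsilon> :: real assume "0 < \<epsilon>"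
    from block_tail_small[OF a_sum this] show "\<exists>N. \<forall>i. \<forall>n\<ge>N. \<forall>m. block (s i) n m \<le> \<epsilon>"
      using s_block order_trans by blast
  qed
  from clopen_NNN_code_limit[OF C this] have "code a \<notin> C"
    using out by simp
  moreover have "limitin CO (\<lambda>i. code (t i)) (code a) sequentially"
  proof (rule limitin_code[OF t_sum a_sum t_ev])
    fix \<epsilon> :: real assume "0 < \<epsilon>"
    then have e: "0 < \<epsilon> / 2" by simp
    from block_tail_small[OF a_sum this] obtain N where N: "\<And>n m. N \<le> n \<Longrightarrow> block a n m \<le> \<epsilon> / 2"
      by blast
    obtain M where M: "(1 / 2 :: real) ^ M < \<epsilon> / 2"
      using real_arch_pow_inv[OF e, of "1/2"] by auto
    have "block (t i) n m \<le> \<epsilon>" if "max N M \<le> n" for i n m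
    proof -
      have "(1 / 2 :: real) ^ n \<le> (1 / 2) ^ M"
        using that by (intro power_decreasing) auto
      then show ?thesis
        using t_block[of i n m] N[of n m] that M by (simp add: power_one_over)
    qed
    then show "\<exists>N. \<forall>i. \<forall>n\<ge>N. \<forall>m. block (t i) n m \<le> \<epsilon>" by blast
  qed
  from clopen_NNN_code_limit[OF C this] have "code a \<in> C"
    using inC by (simp add: t_def)
  ultimately show False by contradiction
qed

theorem theorem4p2:
  shows "\<not> normann_condition NNN"
proof
  let ?A = "{f \<in> topspace NNN. 1 \<le> mass f}"
  assume "normann_condition NNN"
  then have "intersection_of_clopens NNN ?A"
    using functionally_closed_mass by (simp add: normann_condition_def)
  then obtain \<C> where \<C>: "\<forall>C\<in>\<C>. closedin NNN C \<and> openin NNN C" "?A = topspace NNN \<inter> \<Inter>\<C>"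
    unfolding intersection_of_clopens_def by blast
  \<comment> \<open>Each member of \<open>\<C>\<close> is a clopen set containing \<open>?A\<close>,
    so the zero code lies in the intersection although its mass is \<open>0\<close>.\<close>
  have "code (\<lambda>_. 0) \<in> C" if "C \<in> \<C>" for C
    by (rule code_zero_in_clopen) (use \<C> that in auto)
  moreover have "code (\<lambda>_. 0) \<in> topspace NNN"
    by (simp add: topspace_NNN continuous_code)
  ultimately have "1 \<le> mass (code (\<lambda>_. 0))"
    using \<C>(2) by blast
  moreover have "summand (code (\<lambda>_. 0)) = (\<lambda>_. 0)"
    by (simp add: summand_code fun_eq_iff)
  then have "mass (code (\<lambda>_. 0)) = 0"
    by (simp add: mass_def)
  ultimately show False by simp
qed

end
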